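(* For every positive integer $n$, there are at most $n^{2n}$ labelled $n$-vertex graphs in $\mathcal{Q}$, where $\mathcal Q$ is the class of induced subgraphs of hypercubes.
   Context: The $m$-dimensional hypercube $Q_m$ is the graph with vertex set $\{0,1\}^m$ in which two vertices are adjacent if and only if they differ in exactly one coordinate. $\mathcal Q$ is the class of all graphs isomorphic to an induced subgraph of $Q_m$ for some $m$. Labelled $n$-vertex graphs in $\mathcal Q$ are the graphs with vertex set $\{1,\dots,n\}$ that belong to $\mathcal Q$, counted as distinct when their edge sets differ. *)

theory Defs
  imports Complex_Main "HOL-Library.FuncSet"
begin

type_synonym 'a graph = "'a set \<times> 'a set set"

abbreviation verts :: "'a graph \<Rightarrow> 'a set" where
  "verts G \<equiv> fst G"

abbreviation edges :: "'a graph \<Rightarrow> 'a set set" where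
  "edges G \<equiv> snd G"

definition simple_graph :: "'a graph \<Rightarrow> bool" where
  "simple_graph G \<longleftrightarrow> (\<forall>e\<in>edges G. e \<subseteq> verts G \<and> card e = 2)"

definition induced_subgraph :: "'a graph \<Rightarrow> 'a graph \<Rightarrow> bool" where
  "induced_subgraph H G \<longleftrightarrow>
     verts H \<subseteq> verts G \<and> edges H = {e \<in> edges G. e \<subseteq> verts H}"

(* Meant for simple graphs, where {u, u} = {u} is never an edge. *)
definition graph_isomorphic :: "'a graph \<Rightarrow> 'b graph \<Rightarrow> bool" where
  "graph_isomorphic G H \<longleftrightarrow>
     (\<exists>f. bij_betw f (verts G) (verts H) \<and>
          (\<forall>u\<in>verts G. \<forall>v\<in>verts G. {u, v} \<in> edges G \<longleftrightarrow> {f u, f v} \<in> edges H))"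

(* {0,1}^m is the set of extensional functions from {..<m} to {0,1}. *)
definition hypercube :: "nat \<Rightarrow> (nat \<Rightarrow> nat) graph" where
  "hypercube m =
     ({..<m} \<rightarrow>\<^sub>E {0, 1},
      {{x, y} | x y. x \<in> {..<m} \<rightarrow>\<^sub>E {0, 1} \<and> y \<in> {..<m} \<rightarrow>\<^sub>E {0, 1} \<and>
                     (\<exists>!i. i < m \<and> x i \<noteq> y i)})"

definition hypercube_subgraphs :: "'a graph set" where
  "hypercube_subgraphs =
     {G. simple_graph G \<and>
         (\<exists>m H. induced_subgraph H (hypercube m) \<and> graph_isomorphic G H)}"

definition labelled_hypercube_subgraphs :: "nat \<Rightarrow> nat graph set" where
  "labelled_hypercube_subgraphs n = {G \<in> hypercube_subgraphs. verts G = {1..n}}"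

lemma simple_graph_hypercube: "simple_graph (hypercube m)"
  unfolding simple_graph_def
proof
  fix e assume "e \<in> edges (hypercube m)"
  then obtain x y where e: "e = {x, y}" and xy: "x \<in> verts (hypercube m)" "y \<in> verts (hypercube m)"
    and ne: "\<exists>!i. i < m \<and> x i \<noteq> y i"
    unfolding hypercube_def fst_conv snd_conv mem_Collect_eq by (elim exE conjE)
  from ne have "x \<noteq> y" by auto
  with e xy show "e \<subseteq> verts (hypercube m) \<and> card e = 2" by simp
qed

(* The cardinality of this set is therefore a genuine count, not the default value 0. *)
lemma finite_labelled_hypercube_subgraphs: "finite (labelled_hypercube_subgraphs n)"
proof (rule finite_subset)
  show "labelled_hypercube_subgraphs n \<subseteq> {{1..n}} \<times> Pow (Pow {1..n})"
  proof
    fix G assume "G \<in> labelled_hypercube_subgraphs n"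
    then have V: "verts G = {1..n}" and "simple_graph G"
      unfolding labelled_hypercube_subgraphs_def hypercube_subgraphs_def by blast+
    then have "edges G \<in> Pow (Pow {1..n})"
      unfolding simple_graph_def by blast
    with V show "G \<in> {{1..n}} \<times> Pow (Pow {1..n})"
      by (simp add: mem_Times_iff)
  qed
qed simp

end

(* A spanning forest, stored as a parent function p fixing the roots, together with the coordinate
   direction c v of each edge from v to p v, determines the graph: within a component the
   coordinates in which u and v differ are the directions occurring an odd number of times along
   the forest path from u to v, and vertices of different components are never adjacent. At most n
   directions occur on forest edges, so directions can be renamed to elements of {1..n}, which
   leaves at most n^n choices for p and n^n choices for c. *)
theory Submission
  imports Defs
begin

section \<open>Spanning forests given by parent maps\<close>

text \<open>For a forest with parent map \<open>p\<close>, the closure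
  \<open>(parent_rel V p)\<^sup>*\<close> relates vertices of the same tree; a root \<open>v\<close>
  has \<open>p v = v\<close> and contributes only the loop \<open>(v, v)\<close>.\<close>

definition parent_rel :: "'a set \<Rightarrow> ('a \<Rightarrow> 'a) \<Rightarrow> ('a \<times> 'a) set" where
  "parent_rel V p = {(v, p v) | v. v \<in> V} \<union> {(p v, v) | v. v \<in> V}"

lemma sym_parent_rel: "sym (parent_rel V p)"
  unfolding parent_rel_def sym_def by blast

lemma parent_rel_cases:
  assumes "(u, v) \<in> parent_rel V p"
  obtains "u \<in> V" "v = p u" | "v \<in> V" "u = p v"
  using assms unfolding parent_rel_def by blast

text \<open>Each component of \<open>E\<close> gets one root, and every other vertex points to a
  neighbour closer to it. Following parents therefore ends at the root, and the two ends of an edge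
  are joined through their common root.\<close>

lemma spanning_forest_exists:
  assumes "sym E" and "E \<subseteq> V \<times> V"
  obtains p where "\<And>v. p v \<noteq> v \<Longrightarrow> (v, p v) \<in> E"
    and "\<And>u v. (u, v) \<in> E \<Longrightarrow> (u, v) \<in> (parent_rel V p)\<^sup>*"
proof -
  \<comment> \<open>The choice depends only on the set of vertices reachable from \<open>v\<close>.
    Adjacent vertices share this set, so \<open>root\<close> is constant on components.\<close>
  define root where "root v = (SOME x. (v, x) \<in> E\<^sup>*)" for v
  have root: "(v, root v) \<in> E\<^sup>*" for v
    unfolding root_def by (rule someI[of _ v]) simp
  have root_eq: "root u = root v" if "(u, v) \<in> E" for u v
  proof -
    have "(v, u) \<in> E" using that \<open>sym E\<close> by (meson symD)
    with that have "(u, x) \<in> E\<^sup>* \<longleftrightarrow> (v, x) \<in> E\<^sup>*" for x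
      by (meson converse_rtrancl_into_rtrancl)
    then show ?thesis by (simp add: root_def)
  qed
  define dist where "dist v = (LEAST k. (v, root v) \<in> E ^^ k)" for v
  have dist: "(v, root v) \<in> E ^^ dist v" for v
    unfolding dist_def using root[of v] by (metis LeastI rtrancl_power)
  \<comment> \<open>\<open>w\<close> is the second vertex of a shortest walk to the root; by
    \<open>root_eq\<close>, \<open>dist w\<close> is measured to the same root.\<close>
  have step: "\<exists>w. (v, w) \<in> E \<and> dist w < dist v" if "v \<noteq> root v" for v
  proof (cases "dist v")
    case 0
    then show ?thesis using dist[of v] that by simp
  next
    case (Suc k)
    then obtain w where w: "(v, w) \<in> E" "(w, root v) \<in> E ^^ k"
      using dist[of v] by (metis relpow_Suc_D2)
    then have "dist w \<le> k"
      unfolding dist_def using root_eq[OF w(1)] by (simp add: Least_le)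
    with w Suc show ?thesis by auto
  qed
  define p where "p v = (if v = root v then v else SOME w. (v, w) \<in> E \<and> dist w < dist v)" for v
  have p: "(v, p v) \<in> E" "dist (p v) < dist v" if "v \<noteq> root v" for v
    using someI_ex[OF step[OF that]] that by (auto simp: p_def)
  have to_root: "(v, root v) \<in> (parent_rel V p)\<^sup>*" for v
  proof (induction "dist v" arbitrary: v rule: less_induct)
    case less
    show ?case
    proof (cases "v = root v")
      case True
      then show ?thesis by (metis rtrancl.rtrancl_refl)
    next
      case False
      then have "(v, p v) \<in> parent_rel V p"
        using p(1) assms(2) unfolding parent_rel_def by blast
      moreover have "(p v, root v) \<in> (parent_rel V p)\<^sup>*"
        using less[OF p(2)[OF False]] root_eq[OF p(1)[OF False]] by simp
      ultimately show ?thesis by (rule converse_rtrancl_into_rtrancl)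
    qed
  qed
  show thesis
  proof (rule that)
    show "(v, p v) \<in> E" if "p v \<noteq> v" for v
      using that p(1) by (metis p_def)
    show "(u, v) \<in> (parent_rel V p)\<^sup>*" if "(u, v) \<in> E" for u v
    proof -
      have "(root v, v) \<in> (parent_rel V p)\<^sup>*"
        using to_root sym_rtrancl[OF sym_parent_rel] by (meson symD)
      with to_root[of u] root_eq[OF that] show ?thesis by (simp add: rtrancl_trans)
    qed
  qed
qed

section \<open>Graphs encoded by a forest with edge directions\<close>

text \<open>\<open>f v\<close> stands for a cube vertex, given as the set of its coordinates equal
  to 1. Only \<open>p\<close> and \<open>c\<close> form the code; \<open>f\<close> is merely some
  labelling compatible with them. They do not determine label differences between distinct trees, so
  adjacency has to demand a forest path explicitly.\<close>

definition encodes :: "'a set \<Rightarrow> 'a set set \<Rightarrow> ('a \<Rightarrow> 'a) \<Rightarrow> ('a \<Rightarrow> 'c) \<Rightarrow> bool" where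
  "encodes V A p c \<longleftrightarrow>
     (\<exists>f. (\<forall>v\<in>V. p v \<noteq> v \<longrightarrow> sym_diff (f v) (f (p v)) = {c v}) \<and>
          (\<forall>u\<in>V. \<forall>v\<in>V. {u, v} \<in> A \<longleftrightarrow>
             (u, v) \<in> (parent_rel V p)\<^sup>* \<and> is_singleton (sym_diff (f u) (f v))))"

text \<open>Two compatible labellings \<open>f\<close> and \<open>g\<close> may differ, but
  symmetric differences add modulo 2 along a forest path. Hence the difference of two labels in one
  tree is fixed by \<open>p\<close> and \<open>c\<close>.\<close>

lemma encodes_unique:
  assumes "encodes V A p c" and "encodes V B p c" and "u \<in> V" "v \<in> V"
  shows "{u, v} \<in> A \<longleftrightarrow> {u, v} \<in> B"
proof -
  from assms(1) obtain f where
    f: "\<And>v. v \<in> V \<Longrightarrow> p v \<noteq> v \<Longrightarrow> sym_diff (f v) (f (p v)) = {c v}"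
    and A: "{u, v} \<in> A \<longleftrightarrow>
             (u, v) \<in> (parent_rel V p)\<^sup>* \<and> is_singleton (sym_diff (f u) (f v))"
    using assms(3,4) unfolding encodes_def by blast
  from assms(2) obtain g where
    g: "\<And>v. v \<in> V \<Longrightarrow> p v \<noteq> v \<Longrightarrow> sym_diff (g v) (g (p v)) = {c v}"
    and B: "{u, v} \<in> B \<longleftrightarrow>
             (u, v) \<in> (parent_rel V p)\<^sup>* \<and> is_singleton (sym_diff (g u) (g v))"
    using assms(3,4) unfolding encodes_def by blast
  \<comment> \<open>For a non-root both sides are \<open>{c v}\<close>, for a root both are
    empty.\<close>
  have parent: "sym_diff (f v) (f (p v)) = sym_diff (g v) (g (p v))" if "v \<in> V" for v
    using f[OF that] g[OF that] by (cases "p v = v") auto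
  have "sym_diff (f u) (f v) = sym_diff (g u) (g v)" if "(u, v) \<in> (parent_rel V p)\<^sup>*"
    using that
  proof (induction rule: rtrancl_induct)
    case base
    show ?case by simp
  next
    case (step y z)
    have "sym_diff (f y) (f z) = sym_diff (g y) (g z)"
      using step(2) parent by (cases rule: parent_rel_cases) (metis, metis Un_commute)
    with step(3) show ?case by blast
  qed
  with A B show ?thesis by metis
qed

text \<open>All coordinates except the directions \<open>D\<close> of forest edges are discarded,
  and those in \<open>D\<close> are renamed injectively to elements of \<open>V\<close>. Labels in
  one tree differ only within \<open>D\<close>, so no adjacency is lost; singletons arising between
  trees are excluded by the path condition.\<close>

lemma encodes_exists:
  fixes f :: "'a \<Rightarrow> 'c set"
  assumes "finite V" and "V \<noteq> {}"
    and edge: "\<And>u v. u \<in> V \<Longrightarrow> v \<in> V \<Longrightarrow> {u, v} \<in> A \<longleftrightarrow> is_singleton (sym_diff (f u) (f v))"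
  shows "\<exists>p\<in>V \<rightarrow>\<^sub>E V. \<exists>c\<in>V \<rightarrow>\<^sub>E V. encodes V A p c"
proof -
  define E where "E = {(u, v). u \<in> V \<and> v \<in> V \<and> {u, v} \<in> A}"
  have "sym E" "E \<subseteq> V \<times> V"
    unfolding E_def sym_def by (auto simp: insert_commute)
  then obtain p where p: "\<And>v. p v \<noteq> v \<Longrightarrow> (v, p v) \<in> E"
    and conn: "\<And>u v. (u, v) \<in> E \<Longrightarrow> (u, v) \<in> (parent_rel V p)\<^sup>*"
    by (metis spanning_forest_exists)
  have p_in: "p v \<in> V" if "v \<in> V" for v
    using p[of v] that by (cases "p v = v") (auto simp: E_def)
  \<comment> \<open>At a root this is \<open>the_elem {}\<close>, an unspecified value. It is still
    counted in \<open>D\<close>, so that \<open>\<phi> (d v)\<close> lies in \<open>V\<close> for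
    every \<open>v\<close> in \<open>V\<close>, and \<open>card D \<le> card V\<close> holds
    regardless.\<close>
  define d where "d v = the_elem (sym_diff (f v) (f (p v)))" for v
  have d: "sym_diff (f v) (f (p v)) = {d v}" if "v \<in> V" "p v \<noteq> v" for v
  proof -
    have "is_singleton (sym_diff (f v) (f (p v)))"
      using p[OF that(2)] edge by (auto simp: E_def)
    then show ?thesis unfolding d_def by (simp add: is_singleton_the_elem)
  qed
  define D where "D = d ` V"
  have "finite D" "card D \<le> card V"
    using \<open>finite V\<close> by (auto simp: D_def card_image_le)
  then obtain \<phi> where \<phi>: "\<phi> ` D \<subseteq> V" "inj_on \<phi> D"
    using \<open>finite V\<close> by (meson card_le_inj)
  define g where "g v = \<phi> ` (f v \<inter> D)" for v
  have g: "sym_diff (g u) (g v) = \<phi> ` (sym_diff (f u) (f v) \<inter> D)" for u v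
    using \<phi>(2) unfolding g_def inj_on_def by blast
  \<comment> \<open>Restriction puts \<open>q\<close> and \<open>c\<close> into the function space
    that is counted later; \<open>parent_rel V\<close> reads values on \<open>V\<close> only, so the
    forest is unchanged.\<close>
  define q where "q = restrict p V"
  define c where "c = restrict (\<lambda>v. \<phi> (d v)) V"
  have rel: "parent_rel V q = parent_rel V p"
    unfolding parent_rel_def q_def by (auto simp: restrict_def)
  have parent_D: "sym_diff (f v) (f (p v)) \<subseteq> D" if "v \<in> V" for v
    using d[OF that] that unfolding D_def by (cases "p v = v") auto
  have diff_D: "sym_diff (f u) (f v) \<subseteq> D" if "(u, v) \<in> (parent_rel V p)\<^sup>*" for u v
    using that
  proof (induction rule: rtrancl_induct)
    case base
    show ?case by simp
  next
    case (step y z)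
    have "sym_diff (f y) (f z) \<subseteq> D"
      using step(2) parent_D by (cases rule: parent_rel_cases) (metis, metis Un_commute)
    with step(3) show ?case by blast
  qed
  have singleton: "is_singleton (sym_diff (g u) (g v)) \<longleftrightarrow> is_singleton (sym_diff (f u) (f v))"
    if "(u, v) \<in> (parent_rel V p)\<^sup>*" for u v
  proof -
    have "sym_diff (g u) (g v) = \<phi> ` sym_diff (f u) (f v)"
      unfolding g using diff_D[OF that] by (simp add: inf.absorb1)
    moreover have "inj_on \<phi> (sym_diff (f u) (f v))"
      using diff_D[OF that] \<phi>(2) by (rule inj_on_subset[rotated])
    ultimately show ?thesis by (simp add: is_singleton_altdef card_image)
  qed
  have "encodes V A q c"
    unfolding encodes_def rel
  proof (intro exI conjI ballI impI)
    fix v assume v: "v \<in> V" "q v \<noteq> v"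
    then have "sym_diff (f v) (f (p v)) = {d v}" using d by (simp add: q_def)
    then have "sym_diff (g v) (g (p v)) = {\<phi> (d v)}"
      unfolding g using v(1) by (simp add: D_def)
    then show "sym_diff (g v) (g (q v)) = {c v}" using v(1) by (simp add: q_def c_def)
  next
    fix u v assume "u \<in> V" "v \<in> V"
    then show "{u, v} \<in> A \<longleftrightarrow>
        (u, v) \<in> (parent_rel V p)\<^sup>* \<and> is_singleton (sym_diff (g u) (g v))"
      using edge singleton conn[of u v] by (auto simp: E_def)
  qed
  moreover have "q \<in> V \<rightarrow>\<^sub>E V" "c \<in> V \<rightarrow>\<^sub>E V"
    using p_in \<phi>(1) by (auto simp: q_def c_def D_def)
  ultimately show ?thesis by blast
qed

section \<open>Hypercube vertices as sets\<close>

text \<open>A 0/1 vector is identified with its support, and the symmetric difference of two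
  supports is the set of coordinates where the vectors differ.\<close>

lemma hypercube_edge_iff:
  assumes "x \<in> verts (hypercube m)" and "y \<in> verts (hypercube m)"
  shows "{x, y} \<in> edges (hypercube m) \<longleftrightarrow>
    is_singleton (sym_diff {i. i < m \<and> x i = 1} {i. i < m \<and> y i = 1})"
proof -
  have x: "x i = 0 \<or> x i = 1" and y: "y i = 0 \<or> y i = 1" if "i < m" for i
    using assms that unfolding hypercube_def by (auto simp: PiE_iff)
  have diff: "sym_diff {i. i < m \<and> x i = 1} {i. i < m \<and> y i = 1} = {i. i < m \<and> x i \<noteq> y i}"
    using x y by fastforce
  have "{x, y} \<in> edges (hypercube m) \<longleftrightarrow> (\<exists>!i. i < m \<and> x i \<noteq> y i)"
  proof
    assume "{x, y} \<in> edges (hypercube m)"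
    then obtain a b where ab: "{x, y} = {a, b}" "\<exists>!i. i < m \<and> a i \<noteq> b i"
      unfolding hypercube_def snd_conv mem_Collect_eq by (elim exE conjE)
    from ab(1) consider "x = a" "y = b" | "x = b" "y = a"
      unfolding doubleton_eq_iff by blast
    then show "\<exists>!i. i < m \<and> x i \<noteq> y i"
      using ab(2) by cases (simp_all add: eq_commute)
  next
    assume "\<exists>!i. i < m \<and> x i \<noteq> y i"
    with assms show "{x, y} \<in> edges (hypercube m)"
      unfolding hypercube_def fst_conv snd_conv mem_Collect_eq
      by (intro exI[of _ x] exI[of _ y] conjI refl)
  qed
  also have "\<dots> \<longleftrightarrow> is_singleton {i. i < m \<and> x i \<noteq> y i}"
    by (simp add: is_singleton_iff_ex1)
  finally show ?thesis unfolding diff .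
qed

text \<open>The label of a vertex is the support of its image in the cube. Since \<open>H\<close> is
  induced, adjacency of images in \<open>H\<close> is adjacency in the cube.\<close>

lemma hypercube_subgraph_embedding:
  assumes "G \<in> hypercube_subgraphs"
  obtains f :: "'a \<Rightarrow> nat set"
  where "\<And>u v. u \<in> verts G \<Longrightarrow> v \<in> verts G \<Longrightarrow>
    {u, v} \<in> edges G \<longleftrightarrow> is_singleton (sym_diff (f u) (f v))"
proof -
  from assms obtain m H where H: "induced_subgraph H (hypercube m)" and "graph_isomorphic G H"
    unfolding hypercube_subgraphs_def by blast
  then obtain h where bij: "bij_betw h (verts G) (verts H)"
    and h: "\<And>u v. u \<in> verts G \<Longrightarrow> v \<in> verts G \<Longrightarrow>
      {u, v} \<in> edges G \<longleftrightarrow> {h u, h v} \<in> edges H"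
    unfolding graph_isomorphic_def by blast
  show thesis
  proof (rule that)
    fix u v assume uv: "u \<in> verts G" "v \<in> verts G"
    then have hH: "h u \<in> verts H" "h v \<in> verts H"
      using bij by (auto dest: bij_betwE)
    with H have "h u \<in> verts (hypercube m)" "h v \<in> verts (hypercube m)"
      and "{h u, h v} \<in> edges H \<longleftrightarrow> {h u, h v} \<in> edges (hypercube m)"
      unfolding induced_subgraph_def by auto
    with h[OF uv] show "{u, v} \<in> edges G \<longleftrightarrow>
      is_singleton (sym_diff {i. i < m \<and> h u i = 1} {i. i < m \<and> h v i = 1})"
      by (simp only: hypercube_edge_iff)
  qed
qed

text \<open>Decoding compares graphs only on pairs \<open>{u, v}\<close>; in a simple graph every
  edge is such a pair, so this lifts to whole edge sets.\<close>

lemma simple_graph_edges_subset: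
  assumes "simple_graph G" and "verts G = V"
    and "\<And>u v. u \<in> V \<Longrightarrow> v \<in> V \<Longrightarrow> {u, v} \<in> edges G \<Longrightarrow> {u, v} \<in> B"
  shows "edges G \<subseteq> B"
proof
  fix e assume e: "e \<in> edges G"
  with assms(1,2) have "e \<subseteq> V" "card e = 2"
    unfolding simple_graph_def by auto
  then obtain u v where "e = {u, v}" "u \<in> V" "v \<in> V"
    by (auto simp: card_2_iff)
  with assms(3) e show "e \<in> B" by blast
qed

section \<open>Counting the codes\<close>

theorem theorem16:
  fixes n :: nat
  assumes "n \<ge> 1"
  shows "card (labelled_hypercube_subgraphs n) \<le> n ^ (2 * n)"
proof -
  define V where "V = {1..n}"
  define codes where "codes = (V \<rightarrow>\<^sub>E V) \<times> (V \<rightarrow>\<^sub>E V)"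
  have V: "finite V" "V \<noteq> {}" "card V = n"
    using assms by (auto simp: V_def)
  have "\<exists>pc\<in>codes. encodes V (edges G) (fst pc) (snd pc)"
    if "G \<in> labelled_hypercube_subgraphs n" for G
  proof -
    have G: "G \<in> hypercube_subgraphs" "verts G = V"
      using that by (auto simp: labelled_hypercube_subgraphs_def V_def)
    obtain f :: "nat \<Rightarrow> nat set" where
      "\<And>u v. u \<in> V \<Longrightarrow> v \<in> V \<Longrightarrow>
        {u, v} \<in> edges G \<longleftrightarrow> is_singleton (sym_diff (f u) (f v))"
      using hypercube_subgraph_embedding[OF G(1)] G(2) by metis
    from encodes_exists[OF V(1,2) this] show ?thesis
      unfolding codes_def by force
  qed
  \<comment> \<open>A graph may have many codes, so one is chosen for each graph. Injectivity of the
    choice needs only that a code determines its graph.\<close>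
  then obtain enc where enc: "\<And>G. G \<in> labelled_hypercube_subgraphs n \<Longrightarrow> enc G \<in> codes"
    "\<And>G. G \<in> labelled_hypercube_subgraphs n \<Longrightarrow>
      encodes V (edges G) (fst (enc G)) (snd (enc G))"
    by metis
  have "inj_on enc (labelled_hypercube_subgraphs n)"
  proof (rule inj_onI)
    fix G H assume GH: "G \<in> labelled_hypercube_subgraphs n" "H \<in> labelled_hypercube_subgraphs n"
      and eq: "enc G = enc H"
    have same: "{u, v} \<in> edges G \<longleftrightarrow> {u, v} \<in> edges H" if "u \<in> V" "v \<in> V" for u v
      using encodes_unique enc(2)[OF GH(1)] enc(2)[OF GH(2)] that unfolding eq by metis
    have simple: "simple_graph G" "verts G = V" "simple_graph H" "verts H = V"
      using GH by (auto simp: labelled_hypercube_subgraphs_def hypercube_subgraphs_def V_def)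
    have "edges G = edges H"
      using simple_graph_edges_subset[OF simple(1,2)] simple_graph_edges_subset[OF simple(3,4)] same
      by (simp add: subset_antisym)
    with simple show "G = H" by (simp add: prod_eq_iff)
  qed
  moreover have "finite codes"
    using V(1) by (simp add: codes_def finite_PiE)
  ultimately have "card (labelled_hypercube_subgraphs n) \<le> card codes"
    using enc(1) by (intro card_inj_on_le) auto
  also have "card codes = n ^ n * n ^ n"
    using V by (simp add: codes_def card_cartesian_product card_PiE)
  also have "\<dots> = n ^ (2 * n)"
    by (simp add: mult_2 power_add)
  finally show ?thesis .
qed

end
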